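(* Let $\mathcal{M}$ and $\mathcal{N}$ be two $2$-parameter rectangle persistence modules with underlying rectangles $R_\mathcal{M}=(a_1,b_1)\times(a_2,b_2)$ and $R_\mathcal{N}=(c_1,d_1)\times(c_2,d_2)$ respectively, where $a_i,c_i\in\mathbb{R}\cup\{-\infty\}$, $b_i,d_i\in\mathbb{R}\cup\{+\infty\}$, $a_i<b_i$ and $c_i<d_i$ for $i=1,2$. Write $a=(a_1,a_2)$, $b=(b_1,b_2)$, $c=(c_1,c_2)$, $d=(d_1,d_2)$. Then $$d_I(\mathcal{M},\mathcal{N})=\min\Bigg\{\max\Big\{\min_{i=1,2}\frac{b_i-a_i}{2},\ \min_{i=1,2}\frac{d_i-c_i}{2}\Big\},\ \max\Big\{\|c-a\|_\infty,\ \|d-b\|_\infty\Big\}\Bigg\}.$$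
   Context: Fix a field $\mathbb{k}$. On $\mathbb{R}^n$ (here $n=2$), $u\preceq v$ means $u_i\le v_i$ for all $i$. An $n$-parameter persistence module $\mathcal{M}$ is a functor from $(\mathbb{R}^n,\preceq)$ to $\mathbb{k}$-vector spaces: vector spaces $\mathcal{M}_u$ and linear transition maps $\varphi_\mathcal{M}(u,v):\mathcal{M}_u\to\mathcal{M}_v$ for $u\preceq v$, with $\varphi_\mathcal{M}(u,u)=\mathrm{id}$ and $\varphi_\mathcal{M}(v,w)\circ\varphi_\mathcal{M}(u,v)=\varphi_\mathcal{M}(u,w)$. A morphism is a natural transformation. The rectangle persistence module with underlying rectangle $R\subseteq\mathbb{R}^n$ ($R$ a product of $n$ one-parameter intervals) has $\mathcal{M}_u=\mathbb{k}$ for $u\in R$, $\mathcal{M}_u=0$ for $u\notin R$, and $\varphi_\mathcal{M}(u,v)=\mathrm{id}_\mathbb{k}$ for $u\preceq v$ both in $R$ (all other transition maps are zero). For $\epsilon\ge 0$ let $\vec\epsilon=(\epsilon,\dots,\epsilon)$, and let the $\epsilon$-shift $\mathcal{M}(\vec\epsilon)$ be given by $\mathcal{M}(\vec\epsilon)_u=\mathcal{M}_{u+\vec\epsilon}$ and $\varphi_{\mathcal{M}(\vec\epsilon)}(u,v)=\varphi_\mathcal{M}(u+\vec\epsilon,v+\vec\epsilon)$. $\mathcal{M}$ and $\mathcal{N}$ are $\epsilon$-interleaved if there are morphisms $f:\mathcal{M}\to\mathcal{N}(\vec\epsilon)$ and $g:\mathcal{N}\to\mathcal{M}(\vec\epsilon)$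 with $g_{u+\vec\epsilon}\circ f_u=\varphi_\mathcal{M}(u,u+2\vec\epsilon)$ and $f_{u+\vec\epsilon}\circ g_u=\varphi_\mathcal{N}(u,u+2\vec\epsilon)$ for all $u$. The interleaving distance is $d_I(\mathcal{M},\mathcal{N})=\inf\{\epsilon\in[0,+\infty):\mathcal{M},\mathcal{N}\text{ are }\epsilon\text{-interleaved}\}$, equal to $+\infty$ if there is no such $\epsilon$. $\|u\|_\infty=\max_i|u_i|$. Conventions in $\overline{\mathbb{R}}=\mathbb{R}\cup\{\pm\infty\}$: $x+(\pm\infty)=\pm\infty$ for $x\in\mathbb{R}$; $(+\infty)+(+\infty)=+\infty$ and $(-\infty)+(-\infty)=-\infty$ (so $(+\infty)-(-\infty)=+\infty$); $(+\infty)-(+\infty)=0$ and $(-\infty)-(-\infty)=0$; $|\pm\infty|=+\infty$; $-\infty<x<+\infty$ for $x\in\mathbb{R}$. *)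

theory Defs
  imports "HOL-Analysis.Analysis" "Jordan_Normal_Form.Missing_VectorSpace"
begin

text \<open>
  The parameter poset is \<open>real ^ 'n\<close> with the componentwise order \<open>\<le>\<close> of \<^theory>\<open>HOL-Analysis.Finite_Cartesian_Product\<close>.
  Every \<open>fiber M u\<close> carries its own vector space structure over the field \<open>K\<close>; transition maps
  are relevant only on the carrier of their source, so all equations between maps are stated there.
\<close>

record ('k, 'v, 'n) pmod =
  fiber :: "real ^ 'n \<Rightarrow> ('k, 'v) module"
  trans_map :: "real ^ 'n \<Rightarrow> real ^ 'n \<Rightarrow> 'v \<Rightarrow> 'v"

definition persistence_module :: "('k, 'c) ring_scheme \<Rightarrow> ('k, 'v, 'n::finite) pmod \<Rightarrow> bool" where
  "persistence_module K M \<longleftrightarrow>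
     (\<forall>u. vectorspace K (fiber M u)) \<and>
     (\<forall>u v. u \<le> v \<longrightarrow> linear_map K (fiber M u) (fiber M v) (trans_map M u v)) \<and>
     (\<forall>u. \<forall>x\<in>carrier (fiber M u). trans_map M u u x = x) \<and>
     (\<forall>u v w. u \<le> v \<longrightarrow> v \<le> w \<longrightarrow>
        (\<forall>x\<in>carrier (fiber M u). trans_map M v w (trans_map M u v x) = trans_map M u w x))"

definition pmod_morphism ::
  "('k, 'c) ring_scheme \<Rightarrow> ('k, 'v, 'n::finite) pmod \<Rightarrow> ('k, 'w, 'n) pmod
     \<Rightarrow> (real ^ 'n \<Rightarrow> 'v \<Rightarrow> 'w) \<Rightarrow> bool" where
  "pmod_morphism K M N f \<longleftrightarrow>
     (\<forall>u. linear_map K (fiber M u) (fiber N u) (f u)) \<and>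
     (\<forall>u v. u \<le> v \<longrightarrow>
        (\<forall>x\<in>carrier (fiber M u). f v (trans_map M u v x) = trans_map N u v (f u x)))"

text \<open>Below, \<open>vec \<epsilon>\<close> is the constant vector \<open>(\<epsilon>, \<dots>, \<epsilon>)\<close>.\<close>

definition pmod_shift :: "real \<Rightarrow> ('k, 'v, 'n::finite) pmod \<Rightarrow> ('k, 'v, 'n) pmod" where
  "pmod_shift \<epsilon> M =
     \<lparr>fiber = (\<lambda>u. fiber M (u + vec \<epsilon>)),
      trans_map = (\<lambda>u v. trans_map M (u + vec \<epsilon>) (v + vec \<epsilon>))\<rparr>"

definition interleaved ::
  "('k, 'c) ring_scheme \<Rightarrow> real \<Rightarrow> ('k, 'v, 'n::finite) pmod \<Rightarrow> ('k, 'w, 'n) pmod \<Rightarrow> bool" where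
  "interleaved K \<epsilon> M N \<longleftrightarrow>
     (\<exists>f g. pmod_morphism K M (pmod_shift \<epsilon> N) f \<and>
            pmod_morphism K N (pmod_shift \<epsilon> M) g \<and>
            (\<forall>u. \<forall>x\<in>carrier (fiber M u).
               g (u + vec \<epsilon>) (f u x) = trans_map M u (u + vec (2 * \<epsilon>)) x) \<and>
            (\<forall>u. \<forall>y\<in>carrier (fiber N u).
               f (u + vec \<epsilon>) (g u y) = trans_map N u (u + vec (2 * \<epsilon>)) y))"

text \<open>In \<^typ>\<open>ereal\<close> the infimum of the empty set is \<open>\<infinity>\<close>.\<close>

definition interleaving_distance ::
  "('k, 'c) ring_scheme \<Rightarrow> ('k, 'v, 'n::finite) pmod \<Rightarrow> ('k, 'w, 'n) pmod \<Rightarrow> ereal" where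
  "interleaving_distance K M N = Inf {ereal \<epsilon> |\<epsilon>. 0 \<le> \<epsilon> \<and> interleaved K \<epsilon> M N}"

definition field_as_module :: "('k, 'c) ring_scheme \<Rightarrow> ('k, 'k) module" where
  "field_as_module K =
     \<lparr>carrier = carrier K, mult = mult K, one = one K, zero = zero K, add = add K,
      smult = mult K\<rparr>"

definition zero_module :: "('k, 'c) ring_scheme \<Rightarrow> ('k, 'k) module" where
  "zero_module K = (field_as_module K)\<lparr>carrier := {\<zero>\<^bsub>K\<^esub>}\<rparr>"

text \<open>
  This yields a persistence module when \<open>R\<close> is a product of intervals; see
  \<open>persistence_module_rectangle\<close> below.
\<close>

definition rectangle_pmod ::
  "('k, 'c) ring_scheme \<Rightarrow> (real ^ 'n::finite) set \<Rightarrow> ('k, 'k, 'n) pmod" where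
  "rectangle_pmod K R =
     \<lparr>fiber = (\<lambda>u. if u \<in> R then field_as_module K else zero_module K),
      trans_map = (\<lambda>u v x. if u \<in> R \<and> v \<in> R then x else \<zero>\<^bsub>K\<^esub>)\<rparr>"

definition is_rectangle :: "(real ^ 'n::finite) set \<Rightarrow> bool" where
  "is_rectangle R \<longleftrightarrow> (\<exists>I. (\<forall>i. is_interval (I i)) \<and> R = {u. \<forall>i. u $ i \<in> I i})"

definition open_rectangle :: "ereal ^ 'n::finite \<Rightarrow> ereal ^ 'n \<Rightarrow> (real ^ 'n) set" where
  "open_rectangle a b = {u. \<forall>i. a $ i < ereal (u $ i) \<and> ereal (u $ i) < b $ i}"

text \<open>
  The library subtraction on \<^typ>\<open>ereal\<close> has \<open>\<infinity> - \<infinity> = \<infinity>\<close> and \<open>(-\<infinity>) - (-\<infinity>) = \<infinity>\<close>;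
  the convention needed here is that both differences are \<open>0\<close>.
\<close>

definition ereal_diff :: "ereal \<Rightarrow> ereal \<Rightarrow> ereal" where
  "ereal_diff x y = (if \<bar>x\<bar> = \<infinity> \<and> x = y then 0 else x - y)"

definition linf_norm :: "ereal ^ 'n::finite \<Rightarrow> ereal" where
  "linf_norm x = (MAX i. \<bar>x $ i\<bar>)"

lemma is_rectangle_open_rectangle: "is_rectangle (open_rectangle a b)"
proof -
  have "is_interval {t. a $ i < ereal t \<and> ereal t < b $ i}" for i
    unfolding is_interval_1
    using ereal_less_eq(3) le_less_trans less_le_trans by (metis (mono_tags, lifting) mem_Collect_eq)
  then show ?thesis
    unfolding is_rectangle_def open_rectangle_def
    by (intro exI[of _ "\<lambda>i. {t. a $ i < ereal t \<and> ereal t < b $ i}"]) auto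
qed

lemma vectorspace_field_as_module:
  assumes "field K"
  shows "vectorspace K (field_as_module K)"
proof -
  interpret field K by fact
  have "abelian_group (field_as_module K)"
    by (rule abelian_groupI) (auto simp: field_as_module_def a_ac intro: l_neg)
  then have "module K (field_as_module K)"
    by (intro module.intro module_axioms.intro is_cring)
       (auto simp: field_as_module_def l_distr r_distr m_assoc)
  then show ?thesis by (intro vectorspace.intro assms)
qed

lemma vectorspace_zero_module:
  assumes "field K"
  shows "vectorspace K (zero_module K)"
proof -
  interpret field K by fact
  have "abelian_group (zero_module K)"
    by (rule abelian_groupI) (auto simp: field_as_module_def zero_module_def)
  then have "module K (zero_module K)"
    by (intro module.intro module_axioms.intro is_cring)
       (auto simp: field_as_module_def zero_module_def)
  then show ?thesis by (intro vectorspace.intro assms)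
qed

lemma persistence_module_rectangle:
  assumes "field K" "is_rectangle R"
  shows "persistence_module K (rectangle_pmod K R)"
proof -
  interpret field K by fact
  have mid: "v \<in> R" if "u \<in> R" "w \<in> R" "u \<le> v" "v \<le> w" for u v w
    using assms(2) that unfolding is_rectangle_def is_interval_1 less_eq_vec_def by blast
  have vs: "vectorspace K (fiber (rectangle_pmod K R) u)" for u
    by (simp add: rectangle_pmod_def vectorspace_field_as_module vectorspace_zero_module assms)
  have lin: "linear_map K (fiber (rectangle_pmod K R) u) (fiber (rectangle_pmod K R) v)
        (trans_map (rectangle_pmod K R) u v)" for u v
    using vs[of u] vs[of v]
    by (intro linear_map.intro mod_hom.intro mod_hom_axioms.intro)
       (auto simp: vectorspace_def module_hom_def rectangle_pmod_def field_as_module_def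
         zero_module_def split: if_splits)
  show ?thesis
    unfolding persistence_module_def using vs lin
    by (auto simp: rectangle_pmod_def zero_module_def field_as_module_def dest: mid)
qed

end

theory Submission
  imports Defs
begin

text \<open>
  The zero morphisms form an \<open>\<epsilon>\<close>-interleaving as soon as \<open>2\<epsilon>\<close> reaches the shortest side of each
  rectangle, and the maps that are the identity wherever possible form one as soon as
  corresponding endpoints differ by at most \<open>\<epsilon>\<close>. Conversely, if an interleaving exists and one
  rectangle, say that of \<open>M\<close>, has all sides longer than \<open>2\<epsilon>\<close>, then the transition map
  \<open>M\<^sub>u \<rightarrow> M\<^sub>u\<^sub>+\<^sub>2\<^sub>\<epsilon>\<close> is nonzero for some \<open>u\<close> and factors through \<open>N\<^sub>u\<^sub>+\<^sub>\<epsilon>\<close>. Where such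
  \<open>u\<close> can lie bounds the rectangle of \<open>N\<close> from inside; naturality of the two nonzero factors along
  a coordinate direction bounds it from outside.
\<close>

section \<open>Fibers, shifts and linear maps of rectangle modules\<close>

lemma rectangle_pmod_simps [simp]:
  "carrier (fiber (rectangle_pmod K R) u) = (if u \<in> R then carrier K else {\<zero>\<^bsub>K\<^esub>})"
  "zero (fiber (rectangle_pmod K R) u) = \<zero>\<^bsub>K\<^esub>"
  "trans_map (rectangle_pmod K R) u v x = (if u \<in> R \<and> v \<in> R then x else \<zero>\<^bsub>K\<^esub>)"
  by (auto simp: rectangle_pmod_def field_as_module_def zero_module_def)

lemma pmod_shift_simps [simp]:
  "fiber (pmod_shift \<epsilon> M) u = fiber M (u + vec \<epsilon>)"
  "trans_map (pmod_shift \<epsilon> M) u v = trans_map M (u + vec \<epsilon>) (v + vec \<epsilon>)"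
  by (auto simp: pmod_shift_def)

lemma interleaved_sym: "interleaved K \<epsilon> M N \<longleftrightarrow> interleaved K \<epsilon> N M"
  unfolding interleaved_def by blast

lemma linear_map_carrier: "linear_map K V W f \<Longrightarrow> x \<in> carrier V \<Longrightarrow> f x \<in> carrier W"
  unfolding linear_map_def mod_hom_def mod_hom_axioms_def module_hom_def by auto

lemma linear_map_zero: "linear_map K V W f \<Longrightarrow> f (zero V) = zero W"
  using mod_hom.f0_is_0 unfolding linear_map_def by metis

lemma pmod_morphism_natural:
  assumes "pmod_morphism K M N f" "u \<le> v" "x \<in> carrier (fiber M u)"
  shows "f v (trans_map M u v x) = trans_map N u v (f u x)"
  using assms unfolding pmod_morphism_def by blast

text \<open>The free condition \<open>P\<close> serves both constructions of interleavings:
  \<open>False\<close> gives the zero map, \<open>True\<close> the map that is the identity wherever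
  both fibers are the field.\<close>

lemma linear_map_id_or_zero:
  assumes "field K"
  shows "linear_map K (fiber (rectangle_pmod K R) u) (fiber (rectangle_pmod K S) v)
    (\<lambda>x. if u \<in> R \<and> v \<in> S \<and> P then x else \<zero>\<^bsub>K\<^esub>)"
proof -
  interpret field K by fact
  have "vectorspace K (fiber (rectangle_pmod K T) w)" for T :: "(real ^ 'm::finite) set" and w
    by (simp add: rectangle_pmod_def vectorspace_field_as_module vectorspace_zero_module assms)
  from this[of R u] this[of S v] show ?thesis
    by (intro linear_map.intro mod_hom.intro mod_hom_axioms.intro)
       (auto simp: vectorspace_def module_hom_def rectangle_pmod_def field_as_module_def
         zero_module_def split: if_splits)
qed

section \<open>Interleavings from short sides and from close endpoints\<close>

lemma interleaved_if_trans_zero: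
  assumes "field K"
    and "\<And>u. u \<in> R \<Longrightarrow> u + vec (2 * \<epsilon>) \<notin> R" and "\<And>u. u \<in> S \<Longrightarrow> u + vec (2 * \<epsilon>) \<notin> S"
  shows "interleaved K \<epsilon> (rectangle_pmod K R) (rectangle_pmod K S)"
proof -
  have "linear_map K (fiber (rectangle_pmod K A) u) (fiber (rectangle_pmod K B) v) (\<lambda>x. \<zero>\<^bsub>K\<^esub>)"
    for A B :: "(real ^ 'm::finite) set" and u v
    using linear_map_id_or_zero[OF assms(1), of A u B v False] by simp
  then show ?thesis
    unfolding interleaved_def pmod_morphism_def using assms(2,3)
    by (intro exI[of _ "\<lambda>u x. \<zero>\<^bsub>K\<^esub>"]) auto
qed

definition id_or_zero ::
  "('k, 'c) ring_scheme \<Rightarrow> real \<Rightarrow> (real ^ 'n::finite) set \<Rightarrow> (real ^ 'n) set \<Rightarrow> real ^ 'n \<Rightarrow> 'k \<Rightarrow> 'k"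
  where "id_or_zero K \<epsilon> R S u x = (if u \<in> R \<and> u + vec \<epsilon> \<in> S then x else \<zero>\<^bsub>K\<^esub>)"

text \<open>Written with sums rather than differences, so that no convention on infinities enters:
  an infinite endpoint is close to itself and to nothing else.\<close>

definition endpoints_close :: "real \<Rightarrow> ereal ^ 'n::finite \<Rightarrow> ereal ^ 'n \<Rightarrow> bool" where
  "endpoints_close \<epsilon> a c \<longleftrightarrow> (\<forall>i. c $ i \<le> a $ i + ereal \<epsilon> \<and> a $ i \<le> c $ i + ereal \<epsilon>)"

lemma endpoints_close_sym: "endpoints_close \<epsilon> a c \<longleftrightarrow> endpoints_close \<epsilon> c a"
  by (auto simp: endpoints_close_def)

lemma ereal_less_add_shift:
  assumes "c \<le> a + ereal \<epsilon>" "a < ereal t" shows "c < ereal (t + \<epsilon>)"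
  using assms by (cases a; cases c) auto

lemma ereal_add_shift_less:
  assumes "d \<le> b + ereal \<epsilon>" "ereal (t + \<epsilon>) < d" shows "ereal t < b"
  using assms by (cases b; cases d) auto

lemma open_rectangleI_shift:
  assumes "endpoints_close \<epsilon> a c" "u \<in> open_rectangle a b" "\<And>i. ereal (u $ i + \<epsilon>) < d $ i"
  shows "u + vec \<epsilon> \<in> open_rectangle c d"
proof -
  have "c $ i < ereal (u $ i + \<epsilon>)" for i
    using assms(1,2) ereal_less_add_shift[of "c $ i" "a $ i" \<epsilon> "u $ i"]
    by (simp add: open_rectangle_def endpoints_close_def)
  then show ?thesis using assms(3) by (simp add: open_rectangle_def)
qed

text \<open>For \<open>u \<le> v\<close>, each path of the naturality square is the identity or
  zero. Both need \<open>u\<close> in the first rectangle and \<open>v + vec \<epsilon>\<close> in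
  the second; these two conditions already imply the others, that \<open>u + vec \<epsilon>\<close>
  lies in the second (lower endpoints are close) and \<open>v\<close> in the first (upper endpoints
  are close).\<close>

lemma pmod_morphism_id_or_zero:
  assumes "field K" "endpoints_close \<epsilon> a c" "endpoints_close \<epsilon> b d"
  shows "pmod_morphism K (rectangle_pmod K (open_rectangle a b))
    (pmod_shift \<epsilon> (rectangle_pmod K (open_rectangle c d)))
    (id_or_zero K \<epsilon> (open_rectangle a b) (open_rectangle c d))"
proof -
  let ?R = "open_rectangle a b" and ?S = "open_rectangle c d"
  have "linear_map K (fiber (rectangle_pmod K ?R) u) (fiber (rectangle_pmod K ?S) (u + vec \<epsilon>))
      (id_or_zero K \<epsilon> ?R ?S u)" for u
    using linear_map_id_or_zero[OF assms(1), of ?R u ?S "u + vec \<epsilon>" True]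
    by (simp add: id_or_zero_def[abs_def])
  moreover have "u + vec \<epsilon> \<in> ?S" if "u \<le> v" "u \<in> ?R" "v + vec \<epsilon> \<in> ?S" for u v
  proof (rule open_rectangleI_shift[OF assms(2) that(2)])
    fix i
    have "ereal (u $ i + \<epsilon>) \<le> ereal (v $ i + \<epsilon>)" using that(1) by (simp add: less_eq_vec_def)
    also have "\<dots> < d $ i" using that(3) by (simp add: open_rectangle_def)
    finally show "ereal (u $ i + \<epsilon>) < d $ i" .
  qed
  moreover have "v \<in> ?R" if "u \<le> v" "u \<in> ?R" "v + vec \<epsilon> \<in> ?S" for u v
  proof -
    have "a $ i < ereal (v $ i)" for i
      using that(1,2) less_le_trans[of "a $ i" "ereal (u $ i)" "ereal (v $ i)"]
      by (simp add: open_rectangle_def less_eq_vec_def)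
    moreover have "ereal (v $ i) < b $ i" for i
      using that(3) assms(3) ereal_add_shift_less[of "d $ i" "b $ i" \<epsilon> "v $ i"]
      by (simp add: open_rectangle_def endpoints_close_def)
    ultimately show ?thesis by (simp add: open_rectangle_def)
  qed
  ultimately show ?thesis
    unfolding pmod_morphism_def by (auto simp: id_or_zero_def)
qed

text \<open>The two sides could differ only if both ends of the path from \<open>u\<close> to
  \<open>u + vec (2 * \<epsilon>)\<close> lay in the first rectangle and its midpoint missed the
  second. Closeness of the lower endpoints, applied to the start, and of the upper ones, applied to
  the end, excludes this.\<close>

lemma id_or_zero_comp:
  assumes "endpoints_close \<epsilon> a c" "endpoints_close \<epsilon> b d"
  shows "id_or_zero K \<epsilon> (open_rectangle c d) (open_rectangle a b) (u + vec \<epsilon>)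
      (id_or_zero K \<epsilon> (open_rectangle a b) (open_rectangle c d) u x)
    = trans_map (rectangle_pmod K (open_rectangle a b)) u (u + vec (2 * \<epsilon>)) x"
proof -
  have eq: "u + vec \<epsilon> + vec \<epsilon> = u + vec (2 * \<epsilon>)" by (simp add: vec_eq_iff)
  have "u + vec \<epsilon> \<in> open_rectangle c d"
    if u: "u \<in> open_rectangle a b" "u + vec (2 * \<epsilon>) \<in> open_rectangle a b"
  proof (rule open_rectangleI_shift[OF assms(1) u(1)])
    fix i
    have "ereal ((u $ i + \<epsilon>) + \<epsilon>) < b $ i"
      using u(2) by (auto simp: open_rectangle_def add.assoc)
    then show "ereal (u $ i + \<epsilon>) < d $ i"
      using assms(2) by (auto simp: endpoints_close_def intro: ereal_add_shift_less[of "b $ i"])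
  qed
  then show ?thesis by (auto simp: id_or_zero_def eq)
qed

lemma interleaved_if_endpoints_close:
  assumes "field K" "endpoints_close \<epsilon> a c" "endpoints_close \<epsilon> b d"
  shows "interleaved K \<epsilon> (rectangle_pmod K (open_rectangle a b)) (rectangle_pmod K (open_rectangle c d))"
proof -
  have close': "endpoints_close \<epsilon> c a" "endpoints_close \<epsilon> d b"
    using assms(2,3) endpoints_close_sym by auto
  show ?thesis
    unfolding interleaved_def
    by (intro exI[of _ "id_or_zero K \<epsilon> (open_rectangle a b) (open_rectangle c d)"]
        exI[of _ "id_or_zero K \<epsilon> (open_rectangle c d) (open_rectangle a b)"]
        conjI allI ballI pmod_morphism_id_or_zero[OF assms]
        pmod_morphism_id_or_zero[OF assms(1) close'] id_or_zero_comp[OF assms(2,3)]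
        id_or_zero_comp[OF close'])
qed

section \<open>Constraints that an interleaving puts on the endpoints\<close>

text \<open>The composite sends 1 to 1 and \<open>g\<close> sends 0 to 0, so the intermediate value
  is nonzero, which only a fiber over \<open>S\<close> allows. The maps \<open>f\<close> and
  \<open>g\<close> are kept explicit because naturality is later applied to this same pair.\<close>

lemma interleaved_middle_nonzero:
  assumes "field K"
    and f: "pmod_morphism K (rectangle_pmod K R) (pmod_shift \<epsilon> (rectangle_pmod K S)) f"
    and g: "pmod_morphism K (rectangle_pmod K S) (pmod_shift \<epsilon> (rectangle_pmod K R)) g"
    and gf: "\<forall>u. \<forall>x\<in>carrier (fiber (rectangle_pmod K R) u). g (u + vec \<epsilon>) (f u x)
        = trans_map (rectangle_pmod K R) u (u + vec (2 * \<epsilon>)) x"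
    and u: "u \<in> R" "u + vec (2 * \<epsilon>) \<in> R"
  shows "u + vec \<epsilon> \<in> S" "f u \<one>\<^bsub>K\<^esub> \<in> carrier K" "f u \<one>\<^bsub>K\<^esub> \<noteq> \<zero>\<^bsub>K\<^esub>"
    "g (u + vec \<epsilon>) (f u \<one>\<^bsub>K\<^esub>) = \<one>\<^bsub>K\<^esub>"
proof -
  interpret field K by fact
  show 1: "g (u + vec \<epsilon>) (f u \<one>\<^bsub>K\<^esub>) = \<one>\<^bsub>K\<^esub>"
    using gf[rule_format, of "\<one>\<^bsub>K\<^esub>" u] u by simp
  have "g (u + vec \<epsilon>) \<zero>\<^bsub>K\<^esub> = \<zero>\<^bsub>K\<^esub>"
    using g linear_map_zero unfolding pmod_morphism_def pmod_shift_simps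
    by (metis rectangle_pmod_simps(2))
  then show nz: "f u \<one>\<^bsub>K\<^esub> \<noteq> \<zero>\<^bsub>K\<^esub>" using 1 zero_not_one by metis
  have "f u \<one>\<^bsub>K\<^esub> \<in> carrier (fiber (rectangle_pmod K S) (u + vec \<epsilon>))"
    using f linear_map_carrier[of K _ _ "f u" "\<one>\<^bsub>K\<^esub>"] u
    unfolding pmod_morphism_def pmod_shift_simps by fastforce
  then show "u + vec \<epsilon> \<in> S" "f u \<one>\<^bsub>K\<^esub> \<in> carrier K" using nz by (auto split: if_splits)
qed

lemma ereal_dense_shift:
  fixes x y :: ereal
  assumes "x + ereal \<epsilon> < y"
  obtains t where "x < ereal t" "ereal (t + \<epsilon>) < y"
proof -
  obtain s where s: "x + ereal \<epsilon> < ereal s" "ereal s < y" using ereal_dense2[OF assms] by blast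
  then have "x < ereal (s - \<epsilon>)" by (cases x) auto
  with s(2) show ?thesis by (intro that[of "s - \<epsilon>"]) auto
qed

lemma interleaved_imp_endpoints_close:
  fixes a b c d :: "ereal ^ 'n::finite"
  assumes "field K" "0 \<le> \<epsilon>"
    and inter: "interleaved K \<epsilon> (rectangle_pmod K (open_rectangle a b))
      (rectangle_pmod K (open_rectangle c d))"
    and long: "\<And>i. a $ i + ereal (2 * \<epsilon>) < b $ i"
  shows "endpoints_close \<epsilon> a c" "endpoints_close \<epsilon> b d"
proof -
  interpret field K by fact
  let ?R = "open_rectangle a b" and ?S = "open_rectangle c d"
  obtain f g where
    f: "pmod_morphism K (rectangle_pmod K ?R) (pmod_shift \<epsilon> (rectangle_pmod K ?S)) f" and
    g: "pmod_morphism K (rectangle_pmod K ?S) (pmod_shift \<epsilon> (rectangle_pmod K ?R)) g" and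
    gf: "\<forall>u. \<forall>x\<in>carrier (fiber (rectangle_pmod K ?R) u). g (u + vec \<epsilon>) (f u x)
        = trans_map (rectangle_pmod K ?R) u (u + vec (2 * \<epsilon>)) x"
    using inter unfolding interleaved_def by auto
  note mid = interleaved_middle_nonzero[OF assms(1) f g gf]
  have "\<exists>t. a $ i < ereal t \<and> ereal (t + 2 * \<epsilon>) < b $ i" for i
    using ereal_dense_shift[OF long] by blast
  then obtain p where p: "\<And>i. a $ i < ereal (p i)" "\<And>i. ereal (p i + 2 * \<epsilon>) < b $ i" by metis
  have inR: "u \<in> ?R \<and> u + vec (2 * \<epsilon>) \<in> ?R"
    if "\<And>j. a $ j < ereal (u $ j)" "\<And>j. ereal (u $ j + 2 * \<epsilon>) < b $ j" for u
  proof -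
    have "a $ j < ereal (u $ j + 2 * \<epsilon>)" for j
      using that(1)[of j] assms(2) by (cases "a $ j") auto
    moreover have "ereal (u $ j) < b $ j" for j
      using that(2)[of j] assms(2) by (cases "b $ j") auto
    ultimately show ?thesis using that by (auto simp: open_rectangle_def)
  qed
  \<comment> \<open>Filling the other coordinates from \<open>p\<close> makes membership of the
    midpoint in \<open>?S\<close> a condition on coordinate \<open>i\<close> alone.\<close>
  have mid_coord: "c $ i < ereal (t + \<epsilon>) \<and> ereal (t + \<epsilon>) < d $ i"
    if "a $ i < ereal t" "ereal (t + 2 * \<epsilon>) < b $ i" for i t
  proof -
    define u :: "real ^ 'n" where "u = (\<chi> j. if j = i then t else p j)"
    have "u \<in> ?R \<and> u + vec (2 * \<epsilon>) \<in> ?R" using that p by (intro inR) (auto simp: u_def)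
    then have "u + vec \<epsilon> \<in> ?S" using mid(1) by blast
    then have "c $ i < ereal ((u + vec \<epsilon>) $ i) \<and> ereal ((u + vec \<epsilon>) $ i) < d $ i"
      unfolding open_rectangle_def by blast
    then show ?thesis by (simp add: u_def)
  qed
  have ca: "c $ i \<le> a $ i + ereal \<epsilon>" for i
  proof (rule ccontr)
    assume "\<not> ?thesis"
    moreover have "a $ i + ereal \<epsilon> < b $ i - ereal \<epsilon>"
      using long[of i] by (cases "a $ i"; cases "b $ i") auto
    \<comment> \<open>In the minimum, \<open>c $ i\<close> puts the midpoint coordinate
      \<open>t + \<epsilon>\<close> below the rectangle \<open>?S\<close>, while
      \<open>b $ i - ereal \<epsilon>\<close> makes \<open>t\<close> admissible in
      \<open>mid_coord\<close>.\<close>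
    ultimately have "a $ i + ereal \<epsilon> < min (c $ i) (b $ i - ereal \<epsilon>)" by simp
    then obtain t where "a $ i < ereal t" "ereal (t + \<epsilon>) < min (c $ i) (b $ i - ereal \<epsilon>)"
      using ereal_dense_shift by blast
    moreover from this have "ereal (t + 2 * \<epsilon>) < b $ i" by (cases "b $ i") auto
    ultimately show False using mid_coord[of i t] by auto
  qed
  have bd: "b $ i \<le> d $ i + ereal \<epsilon>" for i
  proof (rule ccontr)
    assume "\<not> ?thesis"
    \<comment> \<open>Here \<open>s\<close> is the midpoint coordinate itself: it lies beyond
      \<open>d $ i\<close>, and \<open>s - \<epsilon>\<close> and \<open>s + \<epsilon>\<close>
      still lie between \<open>a $ i\<close> and \<open>b $ i\<close>.\<close>
    then have "max (a $ i + ereal \<epsilon>) (d $ i) + ereal \<epsilon> < b $ i"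
      using long[of i] by (cases "a $ i"; cases "b $ i"; cases "d $ i") (auto simp: max_def)
    then obtain s where s: "max (a $ i + ereal \<epsilon>) (d $ i) < ereal s" "ereal (s + \<epsilon>) < b $ i"
      using ereal_dense_shift by blast
    then have "a $ i < ereal (s - \<epsilon>)" by (cases "a $ i") auto
    then show False using mid_coord[of i "s - \<epsilon>"] s by (auto simp: add.commute)
  qed
  define u :: "real ^ 'n" where "u = (\<chi> j. p j)"
  have u: "u \<in> ?R" "u + vec (2 * \<epsilon>) \<in> ?R" using inR[of u] p by (auto simp: u_def)
  have u_mem: "a $ j < ereal (u $ j)" "ereal (u $ j) < b $ j"
    "c $ j < ereal (u $ j + \<epsilon>)" "ereal (u $ j + \<epsilon>) < d $ j" "a $ j < ereal (u $ j + 2 * \<epsilon>)" for j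
    using u mid(1)[OF u] by (auto simp: open_rectangle_def)
  define y where "y = f u \<one>\<^bsub>K\<^esub>"
  note y = mid(2-4)[OF u, folded y_def]
  have db: "d $ i \<le> b $ i + ereal \<epsilon>" for i
  proof (rule ccontr)
    assume *: "\<not> ?thesis"
    with u_mem(2)[of i] obtain \<beta> where \<beta>: "b $ i = ereal \<beta>" by (cases "b $ i") auto
    \<comment> \<open>Moving coordinate \<open>i\<close> of \<open>u\<close> onto the excluded
      endpoint \<beta> leaves \<open>?R\<close>, while \<open>v + vec \<epsilon>\<close> stays in
      \<open>?S\<close> since \<beta> + \<epsilon> is below \<open>d $ i\<close>. In the naturality
      square of \<open>f\<close> one path then gives 0 and the other the nonzero
      \<open>y\<close>.\<close>
    define v :: "real ^ 'n" where "v = (\<chi> j. if j = i then \<beta> else u $ j)"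
    have le: "u \<le> v" using u_mem(2)[of i] \<beta> by (auto simp: v_def less_eq_vec_def)
    have "v \<notin> ?R" using \<beta> by (auto simp: v_def open_rectangle_def intro!: exI[of _ i])
    moreover have "v + vec \<epsilon> \<in> ?S"
    proof -
      have "c $ i < ereal (\<beta> + \<epsilon>)"
        using u_mem(2)[of i] u_mem(3)[of i] \<beta> by (cases "c $ i") auto
      then show ?thesis using * \<beta> u_mem by (auto simp: v_def open_rectangle_def not_le)
    qed
    moreover have "f v (trans_map (rectangle_pmod K ?R) u v \<one>\<^bsub>K\<^esub>)
        = trans_map (rectangle_pmod K ?S) (u + vec \<epsilon>) (v + vec \<epsilon>) y"
      using pmod_morphism_natural[OF f le, of "\<one>\<^bsub>K\<^esub>"] u by (simp add: y_def)
    moreover have "f v \<zero>\<^bsub>K\<^esub> = \<zero>\<^bsub>K\<^esub>"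
      using f linear_map_zero unfolding pmod_morphism_def pmod_shift_simps
      by (metis rectangle_pmod_simps(2))
    ultimately show False using y mid(1)[OF u] by simp
  qed
  have ac: "a $ i \<le> c $ i + ereal \<epsilon>" for i
  proof (rule ccontr)
    assume *: "\<not> ?thesis"
    with u_mem(1)[of i] obtain \<alpha> where \<alpha>: "a $ i = ereal \<alpha>" by (cases "a $ i") auto
    \<comment> \<open>The shift by \<epsilon> carries coordinate \<open>i\<close> of
      \<open>v\<close> to the excluded endpoint \<alpha>, yet \<open>v\<close> itself lies in
      \<open>?S\<close>. The scalar \<open>y\<close>, now read in the fiber at \<open>v\<close>, is
      transported to \<open>y\<close> at \<open>u + vec \<epsilon>\<close> and sent to 1 by
      \<open>g\<close>; the other path starts in a zero fiber of the first module and gives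
      0.\<close>
    define v :: "real ^ 'n" where "v = (\<chi> j. if j = i then \<alpha> - \<epsilon> else u $ j + \<epsilon>)"
    have le: "v \<le> u + vec \<epsilon>"
      using u_mem(1)[of i] \<alpha> assms(2) by (auto simp: v_def less_eq_vec_def)
    have "v + vec \<epsilon> \<notin> ?R" using \<alpha> by (auto simp: v_def open_rectangle_def intro!: exI[of _ i])
    moreover have vS: "v \<in> ?S"
    proof -
      have "c $ i < ereal (\<alpha> - \<epsilon>)" using * \<alpha> by (cases "c $ i") auto
      moreover have "ereal (\<alpha> - \<epsilon>) < d $ i"
        using u_mem(1)[of i] u_mem(4)[of i] \<alpha> assms(2) by (cases "d $ i") auto
      ultimately show ?thesis using u_mem by (auto simp: v_def open_rectangle_def)
    qed
    moreover have "g (u + vec \<epsilon>) (trans_map (rectangle_pmod K ?S) v (u + vec \<epsilon>) y)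
        = trans_map (rectangle_pmod K ?R) (v + vec \<epsilon>) (u + vec \<epsilon> + vec \<epsilon>) (g v y)"
      using pmod_morphism_natural[OF g le, of y] vS y(1) by simp
    ultimately show False using y mid(1)[OF u] by simp
  qed
  show "endpoints_close \<epsilon> a c" "endpoints_close \<epsilon> b d"
    using ca ac bd db by (auto simp: endpoints_close_def)
qed

section \<open>From endpoint inequalities to the distance formula\<close>

text \<open>The value 0 of \<open>ereal_diff\<close> at equal infinities is what makes this true:
  the right side holds there, whereas the library difference has infinite absolute value.\<close>

lemma abs_ereal_diff_le_iff:
  assumes "0 \<le> \<epsilon>"
  shows "\<bar>ereal_diff y x\<bar> \<le> ereal \<epsilon> \<longleftrightarrow> y \<le> x + ereal \<epsilon> \<and> x \<le> y + ereal \<epsilon>"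
  using assms by (cases x; cases y) (auto simp: ereal_diff_def)

lemma linf_norm_le_iff: "linf_norm x \<le> e \<longleftrightarrow> (\<forall>i. \<bar>x $ i\<bar> \<le> e)"
  by (simp add: linf_norm_def)

lemma endpoints_close_iff:
  assumes "0 \<le> \<epsilon>"
  shows "endpoints_close \<epsilon> a c \<longleftrightarrow> linf_norm (\<chi> i. ereal_diff (c $ i) (a $ i)) \<le> ereal \<epsilon>"
  by (simp add: linf_norm_le_iff endpoints_close_def abs_ereal_diff_le_iff[OF assms])

lemma Min_half_width_le_iff:
  fixes a b :: "ereal ^ 'n::finite"
  assumes "\<forall>i. a $ i < b $ i"
  shows "(MIN i. ereal_diff (b $ i) (a $ i) / 2) \<le> ereal \<epsilon> \<longleftrightarrow> (\<exists>i. b $ i \<le> a $ i + ereal (2 * \<epsilon>))"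
proof -
  have "ereal_diff y x / 2 \<le> ereal \<epsilon> \<longleftrightarrow> y \<le> x + ereal (2 * \<epsilon>)" if "x < y" for x y
    using that by (cases x; cases y) (auto simp: ereal_diff_def)
  then show ?thesis using assms by (simp add: Min_le_iff)
qed

lemma open_rectangle_shift_disjoint:
  assumes "b $ i \<le> a $ i + ereal \<delta>" "u \<in> open_rectangle a b"
  shows "u + vec \<delta> \<notin> open_rectangle a b"
proof
  assume "u + vec \<delta> \<in> open_rectangle a b"
  then have "ereal (u $ i + \<delta>) < b $ i" by (auto simp: open_rectangle_def)
  then have "ereal (u $ i) < a $ i" using assms(1) ereal_add_shift_less by blast
  then show False using assms(2) by (auto simp: open_rectangle_def dest: less_asym)
qed

lemma linf_norm_nonneg: "0 \<le> linf_norm x"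
  by (simp add: linf_norm_def Max_ge_iff)

text \<open>Determines exactly which \<epsilon> admit an interleaving, in any finite number of
  parameters, so that the distance becomes the infimum of a closed half-line.\<close>

lemma interleaved_open_rectangle_iff:
  fixes a b c d :: "ereal ^ 'n::finite"
  assumes "field K" "0 \<le> \<epsilon>" "\<forall>i. a $ i < b $ i" "\<forall>i. c $ i < d $ i"
  shows "interleaved K \<epsilon> (rectangle_pmod K (open_rectangle a b)) (rectangle_pmod K (open_rectangle c d))
    \<longleftrightarrow> min (max (MIN i. ereal_diff (b $ i) (a $ i) / 2) (MIN i. ereal_diff (d $ i) (c $ i) / 2))
        (max (linf_norm (\<chi> i. ereal_diff (c $ i) (a $ i)))
             (linf_norm (\<chi> i. ereal_diff (d $ i) (b $ i)))) \<le> ereal \<epsilon>"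
    (is "?inter \<longleftrightarrow> _")
proof -
  let ?short = "(\<exists>i. b $ i \<le> a $ i + ereal (2 * \<epsilon>)) \<and> (\<exists>i. d $ i \<le> c $ i + ereal (2 * \<epsilon>))"
  let ?close = "endpoints_close \<epsilon> a c \<and> endpoints_close \<epsilon> b d"
  have "?inter \<longleftrightarrow> ?short \<or> ?close"
  proof
    assume ?inter
    \<comment> \<open>If \<open>?short\<close> fails, one of the rectangles has all sides longer
      than \<open>2 * \<epsilon>\<close>. It may be either one, hence the two instances with the
      roles exchanged.\<close>
    then show "?short \<or> ?close"
      using interleaved_imp_endpoints_close[OF assms(1,2), of a b c d]
        interleaved_imp_endpoints_close[OF assms(1,2), of c d a b]
        interleaved_sym endpoints_close_sym not_le by metis
  next
    assume "?short \<or> ?close"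
    then show ?inter
    proof
      assume ?short
      then show ?inter
        using open_rectangle_shift_disjoint interleaved_if_trans_zero[OF assms(1)] by metis
    qed (use interleaved_if_endpoints_close[OF assms(1)] in blast)
  qed
  then show ?thesis
    by (simp only: min_le_iff_disj max.bounded_iff Min_half_width_le_iff[OF assms(3)]
        Min_half_width_le_iff[OF assms(4)] endpoints_close_iff[OF assms(2)])
qed

text \<open>A finite \<open>r\<close> is attained; for \<open>r = \<infinity>\<close> the set is
  empty and its infimum is again \<infinity>.\<close>

lemma Inf_ereal_ge:
  assumes "0 \<le> r"
  shows "Inf {ereal \<epsilon> |\<epsilon>. 0 \<le> \<epsilon> \<and> r \<le> ereal \<epsilon>} = r"
proof (rule antisym)
  show "Inf {ereal \<epsilon> |\<epsilon>. 0 \<le> \<epsilon> \<and> r \<le> ereal \<epsilon>} \<le> r"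
    using assms by (cases r) (auto intro!: Inf_lower)
qed (auto intro: Inf_greatest)

theorem theoremA:
  fixes K :: "('k, 'c) ring_scheme"
    and a b c d :: "ereal ^ 2"
    and M N :: "('k, 'k, 2) pmod"
  assumes "field K"
    and "\<forall>i. a $ i \<noteq> \<infinity>" and "\<forall>i. c $ i \<noteq> \<infinity>"
    and "\<forall>i. b $ i \<noteq> -\<infinity>" and "\<forall>i. d $ i \<noteq> -\<infinity>"
    and "\<forall>i. a $ i < b $ i" and "\<forall>i. c $ i < d $ i"
    and "M = rectangle_pmod K (open_rectangle a b)"
    and "N = rectangle_pmod K (open_rectangle c d)"
  shows "interleaving_distance K M N =
    min (max (MIN i. ereal_diff (b $ i) (a $ i) / 2) (MIN i. ereal_diff (d $ i) (c $ i) / 2))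
        (max (linf_norm (\<chi> i. ereal_diff (c $ i) (a $ i)))
             (linf_norm (\<chi> i. ereal_diff (d $ i) (b $ i))))"
    (is "_ = ?D")
proof -
  \<comment> \<open>Since only nonnegative \<epsilon> compete, a negative \<open>?D\<close> would
    give the infimum 0 instead of \<open>?D\<close>.\<close>
  have "0 \<le> ereal_diff (b $ i) (a $ i) / 2" for i
    using assms(6)[rule_format, of i] by (cases "a $ i"; cases "b $ i") (auto simp: ereal_diff_def)
  then have "0 \<le> ?D" by (simp add: le_max_iff_disj linf_norm_nonneg)
  moreover have "interleaved K \<epsilon> M N \<longleftrightarrow> ?D \<le> ereal \<epsilon>" if "0 \<le> \<epsilon>" for \<epsilon>
    unfolding assms(8,9) by (rule interleaved_open_rectangle_iff[OF assms(1) that assms(6,7)])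
  then have "interleaving_distance K M N = Inf {ereal \<epsilon> |\<epsilon>. 0 \<le> \<epsilon> \<and> ?D \<le> ereal \<epsilon>}"
    unfolding interleaving_distance_def by (intro arg_cong[where f = Inf]) blast
  ultimately show ?thesis by (simp only: Inf_ereal_ge)
qed

end
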